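(* Let $V$ be a finite set of points in $\mathbb{R}^2$ and let $d>0$. For $t>0$, let $\mathcal{U}_t$ denote the set of all Global Spatial Clusters of $V$ with distance threshold $t$, and let $\mathcal{A}_t$ denote the set of all Global Approximate Spatial Clusters of $V$ with distance threshold $t$. Then: (1) for every $U\in\mathcal{U}_d$ there exists $A\in\mathcal{A}_d$ such that $U\subseteq A$; (2) for every $A\in\mathcal{A}_d$ there exists $U'\in\mathcal{U}_{\sqrt{2}\,d}$ such that $A\subseteq U'$.
   Context: $V$ is a finite set of points in the Euclidean plane $\mathbb{R}^2$ (user locations), and $t>0$ is a distance threshold. A set of points is enclosed (covered) by a circle or square if it is contained in the corresponding closed disc or closed square region, boundary included. Global Spatial Cluster (GSC) with threshold $t$: a subset $C\subseteq V$ such that (i) all points of $C$ are enclosed by some circle of diameter $t$; and (ii) there is no $C'\subseteq V$ with $C\subsetneq C'$ whose points are all enclosed by some circle of diameter $t$. Global Approximate Spatial Cluster (GASC) with threshold $t$: a subset $U\subseteq V$ such that (i) there exists an axis-parallel square of side length $t$ covering $U$; and (ii) there is no $U'\subseteq V$ with $U\subsetneq U'$ that is covered by some axis-parallel square of side length $t$. *)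

theory Defs
  imports "HOL-Analysis.Analysis"
begin

definition circle_enclosed :: "real \<Rightarrow> (real^2) set \<Rightarrow> bool" where
  "circle_enclosed t C \<longleftrightarrow> (\<exists>c. C \<subseteq> cball c (t / 2))"

text \<open>The point \<open>a\<close> is the lower left corner of the square and \<open>a + vec t\<close>
  the upper right one.\<close>

definition square_covered :: "real \<Rightarrow> (real^2) set \<Rightarrow> bool" where
  "square_covered t U \<longleftrightarrow> (\<exists>a. U \<subseteq> cbox a (a + vec t))"

definition GSC :: "(real^2) set \<Rightarrow> real \<Rightarrow> (real^2) set set" where
  "GSC V t = {C. C \<subseteq> V \<and> circle_enclosed t C \<and>
     \<not> (\<exists>C'. C' \<subseteq> V \<and> C \<subset> C' \<and> circle_enclosed t C')}"

definition GASC :: "(real^2) set \<Rightarrow> real \<Rightarrow> (real^2) set set" where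
  "GASC V t = {U. U \<subseteq> V \<and> square_covered t U \<and>
     \<not> (\<exists>U'. U' \<subseteq> V \<and> U \<subset> U' \<and> square_covered t U')}"

end

theory Submission
  imports Defs
begin

text \<open>Both parts compare the two shapes and then enlarge. A disc of diameter \<open>t\<close>
  fits into an axis-parallel square of side \<open>t\<close>
  (\<open>circle_enclosed_imp_square_covered\<close>), and a square of side \<open>t\<close> fits
  into the disc on its diagonal, of diameter \<open>sqrt 2 * t\<close>
  (\<open>square_covered_imp_circle_enclosed\<close>). So a cluster of one kind satisfies the
  covering condition of the other kind, though perhaps not maximally. Since \<open>V\<close> is
  finite, it extends to a maximal subset with that condition
  (\<open>finite_maximal_superset\<close>), which is the cluster sought.\<close>

lemma finite_maximal_superset:
  assumes "finite V" "U \<subseteq> V" "P U"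
  shows "\<exists>M. M \<subseteq> V \<and> P M \<and> \<not> (\<exists>M'. M' \<subseteq> V \<and> M \<subset> M' \<and> P M') \<and> U \<subseteq> M"
proof -
  have "finite {M. M \<subseteq> V \<and> P M}"
    using assms(1) by simp
  moreover have "U \<in> {M. M \<subseteq> V \<and> P M}"
    using assms by simp
  ultimately obtain M where "M \<in> {M. M \<subseteq> V \<and> P M}" "U \<subseteq> M"
    "\<forall>B \<in> {M. M \<subseteq> V \<and> P M}. M \<subseteq> B \<longrightarrow> M = B"
    using finite_has_maximal2 by meson
  then show ?thesis by blast
qed

text \<open>The square is the bounding box of the disc: each coordinate of a vector is at most its
  norm in absolute value, so no point strays more than the radius \<open>t / 2\<close> from the
  centre in either direction.\<close>

lemma circle_enclosed_imp_square_covered: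
  assumes "circle_enclosed t C"
  shows "square_covered t C"
proof -
  obtain c where c: "C \<subseteq> cball c (t / 2)"
    using assms by (auto simp: circle_enclosed_def)
  have "cball c (t / 2) \<subseteq> cbox (c - vec (t / 2)) (c - vec (t / 2) + vec t)"
  proof
    fix x assume "x \<in> cball c (t / 2)"
    then have "norm (x - c) \<le> t / 2"
      by (simp add: dist_norm norm_minus_commute)
    then have "\<bar>x $ i - c $ i\<bar> \<le> t / 2" for i
      using component_le_norm_cart[of "x - c" i] by simp
    then have "c $ i - t / 2 \<le> x $ i \<and> x $ i \<le> c $ i - t / 2 + t" for i
      by (smt (verit) field_sum_of_halves)
    then show "x \<in> cbox (c - vec (t / 2)) (c - vec (t / 2) + vec t)"
      by (simp add: mem_box_cart)
  qed
  then show ?thesis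
    using c unfolding square_covered_def by blast
qed

text \<open>The disc is the circumscribed one. Its centre is the midpoint of the square; by
  Pythagoras the squared distance from there is at most twice \<open>(t / 2)\<^sup>2\<close>, the
  square of half the diagonal.\<close>

lemma square_covered_imp_circle_enclosed:
  assumes "square_covered t U"
  shows "circle_enclosed (sqrt 2 * t) U"
proof -
  obtain a where a: "U \<subseteq> cbox a (a + vec t)"
    using assms by (auto simp: square_covered_def)
  have "cbox a (a + vec t) \<subseteq> cball (a + vec (t / 2)) (sqrt 2 * t / 2)"
  proof
    fix x assume "x \<in> cbox a (a + vec t)"
    then have x: "a $ i \<le> x $ i \<and> x $ i \<le> a $ i + t" for i
      by (simp add: mem_box_cart)
    \<comment> \<open>A point in the box forces a nonnegative side length; hence the radius is
      nonnegative, which allows passing from squares back to norms at the end.\<close>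
    have "0 \<le> t" using x[of 1] by linarith
    let ?y = "x - (a + vec (t / 2))"
    have "\<bar>?y $ i\<bar> \<le> t / 2" for i
      unfolding abs_le_iff using x[of i] by simp
    then have sq: "(?y $ i)\<^sup>2 \<le> (t / 2)\<^sup>2" for i
      by (metis abs_ge_zero power2_abs power_mono)
    have "(norm ?y)\<^sup>2 = (?y $ 1)\<^sup>2 + (?y $ 2)\<^sup>2"
      unfolding power2_norm_eq_inner
      by (simp only: inner_vec_def sum_2 power2_eq_square inner_real_def)
    also have "\<dots> \<le> (t / 2)\<^sup>2 + (t / 2)\<^sup>2"
      by (intro add_mono sq)
    also have "\<dots> = (sqrt 2 * t / 2)\<^sup>2"
      by (simp add: power_mult_distrib power_divide)
    finally have "norm ?y \<le> sqrt 2 * t / 2"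
      by (rule power2_le_imp_le) (simp add: \<open>0 \<le> t\<close>)
    then show "x \<in> cball (a + vec (t / 2)) (sqrt 2 * t / 2)"
      by (subst mem_cball, subst dist_commute) (simp only: dist_norm)
  qed
  then show ?thesis
    using a unfolding circle_enclosed_def by blast
qed

theorem theorem1:
  fixes V :: "(real^2) set" and d :: real
  assumes "finite V" and "d > 0"
  shows "(\<forall>U \<in> GSC V d. \<exists>A \<in> GASC V d. U \<subseteq> A) \<and>
         (\<forall>A \<in> GASC V d. \<exists>U' \<in> GSC V (sqrt 2 * d). A \<subseteq> U')"
proof (intro conjI ballI)
  fix U assume "U \<in> GSC V d"
  then have "U \<subseteq> V" "square_covered d U"
    by (auto simp: GSC_def circle_enclosed_imp_square_covered)
  \<comment> \<open>Maximality is taken among the square-covered subsets of \<open>V\<close>, so the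
    superset obtained is a member of \<open>GASC V d\<close>.\<close>
  from finite_maximal_superset[of V U "square_covered d", OF assms(1) this]
  show "\<exists>A \<in> GASC V d. U \<subseteq> A"
    unfolding GASC_def by blast
next
  fix A assume "A \<in> GASC V d"
  then have "A \<subseteq> V" "circle_enclosed (sqrt 2 * d) A"
    by (auto simp: GASC_def square_covered_imp_circle_enclosed)
  from finite_maximal_superset[of V A "circle_enclosed (sqrt 2 * d)", OF assms(1) this]
  show "\<exists>U' \<in> GSC V (sqrt 2 * d). A \<subseteq> U'"
    unfolding GSC_def by blast
qed

end
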